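(* Let $m,n$ be positive integers and let $\mathcal{M}\in\mathbb{R}^{[2m,n]}$. The following statements are equivalent: (i) $\mathcal{M}$ is $T$-column sufficient; (ii) the set $\mathrm{SOL}(\mathcal{M},\mathcal{Q})$ is a convex set for all $\mathcal{Q}\in\mathbb{R}^{[m,n]}$.
   Context: Write $[n]=\{1,\dots,n\}$. $\mathbb{R}^{[m,n]}$ denotes the set of $m$-th order $n$-dimensional real tensors $\mathcal{Z}=(z_{i_1\ldots i_m})$ with $i_j\in[n]$ for $j\in[m]$; it is a real vector space with entrywise operations and inner product $\langle\mathcal{X},\mathcal{Y}\rangle=\sum_{i_1,\dots,i_m=1}^n x_{i_1\ldots i_m}y_{i_1\ldots i_m}$. $\mathcal{Z}\ge\mathcal{O}$ means all entries of $\mathcal{Z}$ are nonnegative ($\mathcal{O}$ is the zero tensor). For $\mathcal{M}=(m_{i_1\ldots i_{2m}})\in\mathbb{R}^{[2m,n]}$ and $\mathcal{Z}\in\mathbb{R}^{[m,n]}$, the tensor $\mathcal{M}\mathcal{Z}\in\mathbb{R}^{[m,n]}$ is defined by $(\mathcal{M}\mathcal{Z})_{i_1\ldots i_m}=\sum_{i_{m+1},\dots,i_{2m}=1}^n m_{i_1\ldots i_m i_{m+1}\ldots i_{2m}}z_{i_{m+1}\ldots i_{2m}}$. $\mathcal{M}\in\mathbb{R}^{[2m,n]}$ is $T$-column sufficient if for every $\mathcal{Z}\in\mathbb{R}^{[m,n]}$: if $z_{i_1\ldots i_m}(\mathcal{M}\mathcal{Z})_{i_1\ldots i_m}\le 0$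 for all $i_1,\dots,i_m\in[n]$, then $z_{i_1\ldots i_m}(\mathcal{M}\mathcal{Z})_{i_1\ldots i_m}=0$ for all $i_1,\dots,i_m\in[n]$. For $\mathcal{M}\in\mathbb{R}^{[2m,n]}$ and $\mathcal{Q}\in\mathbb{R}^{[m,n]}$, the problem $\mathrm{TLCP}(\mathcal{M},\mathcal{Q})$ is to find $\mathcal{Z}\in\mathbb{R}^{[m,n]}$ with $\mathcal{Z}\ge\mathcal{O}$, $\mathcal{M}\mathcal{Z}+\mathcal{Q}\ge\mathcal{O}$ and $\langle\mathcal{Z},\mathcal{M}\mathcal{Z}+\mathcal{Q}\rangle=0$. $\mathrm{SOL}(\mathcal{M},\mathcal{Q})$ is the set of all such $\mathcal{Z}$. *)

theory Defs
  imports "HOL-Analysis.Analysis"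
begin

text \<open>
  A tensor of order \<open>CARD('m)\<close> and dimension \<open>CARD('n)\<close> is a real vector indexed by the multi-indices
  \<open>i :: 'm \<Rightarrow> 'n\<close>, where \<open>'m\<close> is the type of positions and \<open>'n\<close> the type of index values.
  Since \<open>'m\<close> and \<open>'n\<close> are arbitrary finite (nonempty) types, \<open>m = CARD('m)\<close> and \<open>n = CARD('n)\<close> are
  arbitrary positive integers. The order relation, inner product and linear structure of the library
  on \<^typ>\<open>real ^ 'i\<close> are the entrywise ones.

  A tensor of order \<open>2m\<close> has the positions \<open>'m + 'm\<close>: \<open>Inl\<close> marks the first \<open>m\<close> positions, \<open>Inr\<close> the
  last \<open>m\<close>. The concatenation of multi-indices \<open>i\<close> and \<open>j\<close> is therefore \<open>case_sum i j\<close>.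
\<close>

type_synonym ('m, 'n) tensor = "(real, 'm \<Rightarrow> 'n) vec"

definition tensor_app ::
    "('m::finite + 'm, 'n::finite) tensor \<Rightarrow> ('m, 'n) tensor \<Rightarrow> ('m, 'n) tensor" where
  "tensor_app M Z = (\<chi> i. \<Sum>j\<in>UNIV. M $ case_sum i j * Z $ j)"

definition T_column_sufficient :: "('m::finite + 'm, 'n::finite) tensor \<Rightarrow> bool" where
  "T_column_sufficient M \<longleftrightarrow>
     (\<forall>Z :: ('m, 'n) tensor.
        (\<forall>i. Z $ i * tensor_app M Z $ i \<le> 0) \<longrightarrow> (\<forall>i. Z $ i * tensor_app M Z $ i = 0))"

definition SOL ::
    "('m::finite + 'm, 'n::finite) tensor \<Rightarrow> ('m, 'n) tensor \<Rightarrow> ('m, 'n) tensor set" where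
  "SOL M Q = {Z. Z \<ge> 0 \<and> tensor_app M Z + Q \<ge> 0 \<and> Z \<bullet> (tensor_app M Z + Q) = 0}"

end

theory Submission imports Defs
begin

text \<open>
  For nonnegative vectors orthogonality is entrywise, so \<open>Z \<in> SOL M Q\<close> says that in each entry
  \<open>Z\<close> and its slack \<open>W = M Z + Q\<close> are nonnegative and one of them vanishes
  (\<open>SOL_iff_entrywise\<close>). A convex combination of solutions \<open>Z\<close>, \<open>Z'\<close> has the same convex
  combination of \<open>W\<close>, \<open>W'\<close> as its slack, so it is a solution as soon as the cross products
  \<open>Z\<^sub>i W'\<^sub>i\<close> and \<open>Z'\<^sub>i W\<^sub>i\<close> vanish. Both directions concern these cross products.

  If \<open>M\<close> is column sufficient, apply the property to \<open>D = Z - Z'\<close>: since \<open>M D = W - W'\<close>,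
  complementarity gives \<open>D\<^sub>i (M D)\<^sub>i = - (Z\<^sub>i W'\<^sub>i + Z'\<^sub>i W\<^sub>i) \<le> 0\<close>, so these sums of two
  nonnegative terms all vanish.

  Conversely, let \<open>Z\<close> and \<open>Y = M Z\<close> satisfy \<open>Z\<^sub>i Y\<^sub>i \<le> 0\<close> in all entries. For a suitable \<open>Q\<close>, the
  positive and negative parts of \<open>Z\<close> are both solutions, with the positive and negative parts
  of \<open>Y\<close> as their slacks. If the solution set is convex, their midpoint is a solution too, and
  its complementarity reads \<open>\<bar>Z\<^sub>i\<bar> \<bar>Y\<^sub>i\<bar> / 4 = 0\<close>.
\<close>

lemma linear_tensor_app: "linear (tensor_app M)"
  by (rule linearI)
    (simp_all add: tensor_app_def vec_eq_iff ring_distribs sum.distrib sum_distrib_left mult.left_commute)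

lemma SOL_iff_entrywise:
  "Z \<in> SOL M Q \<longleftrightarrow>
    (\<forall>i. 0 \<le> Z $ i \<and> 0 \<le> (tensor_app M Z + Q) $ i \<and> Z $ i * (tensor_app M Z + Q) $ i = 0)"
proof -
  define W where "W = tensor_app M Z + Q"
  have "Z \<bullet> W = 0 \<longleftrightarrow> (\<forall>i. Z $ i * W $ i = 0)" if "\<forall>i. 0 \<le> Z $ i" "\<forall>i. 0 \<le> W $ i"
    using that by (simp add: inner_vec_def sum_nonneg_eq_0_iff del: mult_eq_0_iff)
  then show ?thesis
    unfolding SOL_def mem_Collect_eq W_def[symmetric] by (auto simp: less_eq_vec_def)
qed

lemma T_column_sufficient_imp_convex_SOL:
  assumes "T_column_sufficient M"
  shows "convex (SOL M Q)"
proof (rule convexI)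
  fix Z Z' and u v :: real
  assume sol: "Z \<in> SOL M Q" "Z' \<in> SOL M Q" and uv: "0 \<le> u" "0 \<le> v" "u + v = 1"
  define W where "W = tensor_app M Z + Q"
  define W' where "W' = tensor_app M Z' + Q"
  have Z: "0 \<le> Z $ i" "0 \<le> W $ i" "Z $ i * W $ i = 0"
    and Z': "0 \<le> Z' $ i" "0 \<le> W' $ i" "Z' $ i * W' $ i = 0" for i
    using sol unfolding SOL_iff_entrywise W_def W'_def by blast+
  have D: "(Z - Z') $ i * tensor_app M (Z - Z') $ i = - (Z $ i * W' $ i + Z' $ i * W $ i)" for i
  proof -
    have MD: "tensor_app M (Z - Z') = W - W'"
      by (simp add: W_def W'_def linear_diff[OF linear_tensor_app])
    show ?thesis
      unfolding MD using Z(3)[of i] Z'(3)[of i] by (auto simp: algebra_simps)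
  qed
  have nonneg: "0 \<le> Z $ i * W' $ i" "0 \<le> Z' $ i * W $ i" for i
    using Z Z' by simp_all
  have "(Z - Z') $ i * tensor_app M (Z - Z') $ i \<le> 0" for i
    unfolding D using nonneg[of i] by linarith
  then have D0: "(Z - Z') $ i * tensor_app M (Z - Z') $ i = 0" for i
    using assms unfolding T_column_sufficient_def by blast
  have cross: "Z $ i * W' $ i = 0" "Z' $ i * W $ i = 0" for i
    using D[of i] D0[of i] nonneg[of i] by linarith+
  have slack: "tensor_app M (u *\<^sub>R Z + v *\<^sub>R Z') + Q = u *\<^sub>R W + v *\<^sub>R W'"
  proof -
    have "Q = u *\<^sub>R Q + v *\<^sub>R Q"
      using uv(3) by (metis scaleR_add_left scaleR_one)
    then show ?thesis
      by (simp add: W_def W'_def linear_add[OF linear_tensor_app] linear_scale[OF linear_tensor_app]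
          scaleR_add_right)
  qed
  have "(u * Z $ i + v * Z' $ i) * (u * W $ i + v * W' $ i) = 0" for i
  proof -
    have "(u * Z $ i + v * Z' $ i) * (u * W $ i + v * W' $ i)
        = u * u * (Z $ i * W $ i) + u * v * (Z $ i * W' $ i)
          + v * u * (Z' $ i * W $ i) + v * v * (Z' $ i * W' $ i)"
      by (simp add: algebra_simps)
    also have "\<dots> = 0"
      by (simp only: Z(3) Z'(3) cross mult_zero_right add_0_right)
    finally show ?thesis .
  qed
  then show "u *\<^sub>R Z + v *\<^sub>R Z' \<in> SOL M Q"
    unfolding SOL_iff_entrywise slack using Z Z' uv by (simp del: mult_eq_0_iff)
qed

lemma convex_SOL_imp_T_column_sufficient:
  fixes M :: "('m::finite + 'm, 'n::finite) tensor"
  assumes convex: "\<And>Q. convex (SOL M Q)"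
  shows "T_column_sufficient M"
  unfolding T_column_sufficient_def
proof (intro allI impI)
  fix Z :: "('m, 'n) tensor" and i
  assume nonpos: "\<forall>i. Z $ i * tensor_app M Z $ i \<le> 0"
  define Y where "Y = tensor_app M Z"
  define Zp :: "('m, 'n) tensor" where "Zp = (\<chi> i. max (Z $ i) 0)"
  define Zn :: "('m, 'n) tensor" where "Zn = (\<chi> i. max (- Z $ i) 0)"
  define Yp :: "('m, 'n) tensor" where "Yp = (\<chi> i. max (Y $ i) 0)"
  define Yn :: "('m, 'n) tensor" where "Yn = (\<chi> i. max (- Y $ i) 0)"
  \<comment> \<open>The slack of \<open>Zp\<close> becomes \<open>Yp\<close>; that of \<open>Zn\<close> is then \<open>Yn\<close>, because
    \<open>M Zp - M Zn = M Z = Yp - Yn\<close>.\<close>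
  define Q where "Q = Yp - tensor_app M Zp"
  have slack_p: "tensor_app M Zp + Q = Yp"
    by (simp add: Q_def)
  have slack_n: "tensor_app M Zn + Q = Yn"
  proof -
    have "Z = Zp - Zn" "Y = Yp - Yn"
      by (auto simp: vec_eq_iff Zp_def Zn_def Yp_def Yn_def)
    then have "tensor_app M Zp - tensor_app M Zn = Yp - Yn"
      by (metis Y_def linear_diff[OF linear_tensor_app])
    then show ?thesis
      by (simp add: Q_def algebra_simps)
  qed
  have opposite: "(Z $ i \<le> 0 \<or> Y $ i \<le> 0) \<and> (0 \<le> Z $ i \<or> 0 \<le> Y $ i)" for i
    using nonpos[rule_format, of i] unfolding Y_def[symmetric] mult_le_0_iff by linarith
  have "Zp \<in> SOL M Q"
    unfolding SOL_iff_entrywise slack_p using opposite by (auto simp: Zp_def Yp_def max_def)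
  moreover have "Zn \<in> SOL M Q"
    unfolding SOL_iff_entrywise slack_n using opposite by (auto simp: Zn_def Yn_def max_def)
  ultimately have mid: "(1/2) *\<^sub>R Zp + (1/2) *\<^sub>R Zn \<in> SOL M Q"
    by (intro convexD[OF convex]) simp_all
  have "tensor_app M ((1/2) *\<^sub>R Zp + (1/2) *\<^sub>R Zn) + Q
      = (1/2) *\<^sub>R (tensor_app M Zp + Q) + (1/2) *\<^sub>R (tensor_app M Zn + Q)"
    by (simp add: linear_add[OF linear_tensor_app] linear_scale[OF linear_tensor_app]
        vec_eq_iff field_simps)
  then have "tensor_app M ((1/2) *\<^sub>R Zp + (1/2) *\<^sub>R Zn) + Q = (1/2) *\<^sub>R Yp + (1/2) *\<^sub>R Yn"
    unfolding slack_p slack_n .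
  with mid have "((1/2) *\<^sub>R Zp + (1/2) *\<^sub>R Zn) $ i * ((1/2) *\<^sub>R Yp + (1/2) *\<^sub>R Yn) $ i = 0"
    unfolding SOL_iff_entrywise by metis
  moreover have "((1/2) *\<^sub>R Zp + (1/2) *\<^sub>R Zn) $ i = \<bar>Z $ i\<bar> / 2"
    "((1/2) *\<^sub>R Yp + (1/2) *\<^sub>R Yn) $ i = \<bar>Y $ i\<bar> / 2"
    by (simp_all add: Zp_def Zn_def Yp_def Yn_def max_def abs_if)
  ultimately have "\<bar>Z $ i\<bar> / 2 * (\<bar>Y $ i\<bar> / 2) = 0"
    by metis
  then show "Z $ i * tensor_app M Z $ i = 0"
    by (simp add: Y_def)
qed

theorem theorem4p1:
  fixes M :: "('m::finite + 'm, 'n::finite) tensor"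
  shows "T_column_sufficient M \<longleftrightarrow> (\<forall>Q :: ('m, 'n) tensor. convex (SOL M Q))"
  using T_column_sufficient_imp_convex_SOL convex_SOL_imp_T_column_sufficient by blast

end
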